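(* For every integer $m\ge 1$, the $m$th permutation moment $\mu_m$ is pattern-finite. Explicitly, $$\mu_m=\sum_{\substack{p,q\in\mathcal{S}\\ |p|+|q|\le m}}\kappa(m,|p|,|q|)\cdot[q\ominus 1\ominus p],$$ where $$\kappa(m,a,b):=\sum_{k=b}^{m-a}(-1)^k\binom{m}{k}\,a!\,S(m-k,a)\,b!\,S(k,b).$$
   Context: $S_n$ is the set of permutations of $[1,n]=\{1,\dots,n\}$ (with $S_0=\{\varnothing\}$), $\mathcal{S}=\bigsqcup_{n\ge 0}S_n$, and $|w|=n$ for $w\in S_n$. A permutation statistic is a function on $\mathcal{S}$. For $p\in S_k$ and $w\in S_n$, an occurrence of $p$ in $w$ is a choice of indices $1\le i_1<\dots<i_k\le n$ such that $w(i_1)\cdots w(i_k)$ is order isomorphic to $p(1)\cdots p(k)$; the pattern-count function $[p]\colon\mathcal{S}\to\mathbb{N}$ sends $w$ to the number of occurrences of $p$ in $w$ (so $[\varnothing]$ is constantly $1$). Every statistic is uniquely a (possibly infinite) linear combination of pattern-count functions; it is pattern-finite if only finitely many coefficients are nonzero. The $m$th permutation moment is $\mu_m(w)=\sum_{i=1}^\infty (w(i)-i)^m$, where by convention $w(i)=i$ for $i>|w|$. For $p\in S_a$ and $q\in S_b$, the skew sum $p\ominus q\in S_{a+b}$ is defined by $(p\ominus q)(i)=b+p(i)$ for $1\le i\le a$ and $(p\ominus q)(i)=q(i-a)$ for $a+1\le i\le a+b$. Here $1$ denotes the unique element of $S_1$. $S(n,k)$ is the Stirling number of the second kind, the number of set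 partitions of $[1,n]$ into $k$ nonempty blocks (so $S(0,0)=1$); equivalently $k!\,S(n,k)$ is the number of surjections $[1,n]\to[1,k]$. *)

theory Defs
  imports
    "HOL-Combinatorics.Permutations"
    "HOL-Combinatorics.Stirling"
    "HOL-Analysis.Infinite_Sum"
begin

text \<open>
  \<open>fperm\<close> is the disjoint union of the \<open>S\<^sub>n\<close>. The size is stored because \<open>\<sigma> permutes {1..n}\<close>
  fixes everything outside \<open>{1..n}\<close> and therefore does not determine \<open>n\<close>; it is also what
  makes the convention \<open>w(i) = i\<close> for \<open>i > |w|\<close> hold automatically.
\<close>

typedef fperm = "{(n :: nat, \<sigma> :: nat \<Rightarrow> nat). \<sigma> permutes {1..n}}"
proof
  show "(0, id) \<in> {(n :: nat, \<sigma> :: nat \<Rightarrow> nat). \<sigma> permutes {1..n}}"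
    by (simp add: permutes_id)
qed

setup_lifting type_definition_fperm

lift_definition psize :: "fperm \<Rightarrow> nat" is fst .

lift_definition papp :: "fperm \<Rightarrow> nat \<Rightarrow> nat" is snd .

lemma papp_permutes: "papp w permutes {1..psize w}"
  by transfer auto

lemma fperm_eqI: "psize v = psize w \<Longrightarrow> papp v = papp w \<Longrightarrow> v = w"
  by transfer auto

lift_definition perm_one :: fperm is "(1, id)"
  by (simp add: permutes_id)

definition skew_fun :: "nat \<Rightarrow> (nat \<Rightarrow> nat) \<Rightarrow> nat \<Rightarrow> (nat \<Rightarrow> nat) \<Rightarrow> nat \<Rightarrow> nat" where
  "skew_fun a p b q i =
     (if 1 \<le> i \<and> i \<le> a then b + p i
      else if a + 1 \<le> i \<and> i \<le> a + b then q (i - a)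
      else i)"

lemma skew_fun_permutes:
  assumes p: "p permutes {1..a}" and q: "q permutes {1..b}"
  shows "skew_fun a p b q permutes {1..a + b}"
proof -
  let ?f = "skew_fun a p b q"
  have p_rng: "1 \<le> p i \<and> p i \<le> a" if "1 \<le> i" "i \<le> a" for i
    using permutes_in_image[OF p, of i] that by simp
  have q_rng: "1 \<le> q i \<and> q i \<le> b" if "1 \<le> i" "i \<le> b" for i
    using permutes_in_image[OF q, of i] that by simp
  have p_inj: "p i = p j \<Longrightarrow> i = j" for i j
    using permutes_inj[OF p] by (rule injD)
  have q_inj: "q i = q j \<Longrightarrow> i = j" for i j
    using permutes_inj[OF q] by (rule injD)
  have low: "?f i = b + p i" "1 \<le> p i" "p i \<le> a" if "1 \<le> i" "i \<le> a" for i
    using that p_rng[OF that] by (simp_all add: skew_fun_def)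
  have high: "?f i = q (i - a)" "1 \<le> q (i - a)" "q (i - a) \<le> b"
    if "a < i" "i \<le> a + b" for i
    using that q_rng[of "i - a"] by (simp_all add: skew_fun_def)
  have rng: "?f i \<in> {1..a + b}" if "i \<in> {1..a + b}" for i
    using that low[of i] high[of i] by (cases "i \<le> a") simp_all
  have inj: "inj_on ?f {1..a + b}"
  proof (rule inj_onI)
    fix i j
    assume ij: "i \<in> {1..a + b}" "j \<in> {1..a + b}" and e: "?f i = ?f j"
    consider "i \<le> a" "j \<le> a" | "i \<le> a" "a < j" | "a < i" "j \<le> a" | "a < i" "a < j"
      by linarith
    then show "i = j"
    proof cases
      case 1
      with ij e low(1)[of i] low(1)[of j] have "p i = p j" by simp
      then show ?thesis by (rule p_inj)
    next
      case 2
      with ij e low[of i] high[of j] show ?thesis by simp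
    next
      case 3
      with ij e low[of j] high[of i] show ?thesis by simp
    next
      case 4
      with ij e high(1)[of i] high(1)[of j] have "q (i - a) = q (j - a)" by simp
      then have "i - a = j - a" by (rule q_inj)
      with 4 show ?thesis by simp
    qed
  qed
  have "?f ` {1..a + b} = {1..a + b}"
    using rng inj by (intro endo_inj_surj) auto
  with inj have "bij_betw ?f {1..a + b} {1..a + b}"
    by (simp add: bij_betw_def)
  moreover have "?f i = i" if "i \<notin> {1..a + b}" for i
    using that unfolding skew_fun_def by auto
  ultimately show ?thesis
    by (rule bij_imp_permutes)
qed

lift_definition skew_sum :: "fperm \<Rightarrow> fperm \<Rightarrow> fperm" (infixl "\<ominus>" 65)
  is "\<lambda>(a, p) (b, q). (a + b, skew_fun a p b q)"
  using skew_fun_permutes by auto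

text \<open>
  The choice of indices \<open>i\<^sub>1 < \<dots> < i\<^sub>k\<close> is an extensional function on \<open>{1..k}\<close>, so that each
  choice is counted once.
\<close>

definition occurrences :: "fperm \<Rightarrow> fperm \<Rightarrow> (nat \<Rightarrow> nat) set" where
  "occurrences p w =
     {\<iota> \<in> {1..psize p} \<rightarrow>\<^sub>E {1..psize w}.
        strict_mono_on {1..psize p} \<iota> \<and>
        (\<forall>r\<in>{1..psize p}. \<forall>s\<in>{1..psize p}.
           papp w (\<iota> r) < papp w (\<iota> s) \<longleftrightarrow> papp p r < papp p s)}"

definition pattern_count :: "fperm \<Rightarrow> fperm \<Rightarrow> nat" where
  "pattern_count p w = card (occurrences p w)"

text \<open>
  An infinite linear combination \<open>\<Sum>\<^sub>p c p [p]\<close> is evaluated pointwise; at \<open>w\<close> only the patterns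
  with \<open>|p| \<le> |w|\<close> contribute (lemma \<open>pattern_count_eq_0\<close>), and there are finitely many of
  them (lemma \<open>finite_psize_le\<close>). Coefficients live in the ring of values of the statistic.
\<close>

definition pattern_expansion :: "(fperm \<Rightarrow> 'a::comm_ring_1) \<Rightarrow> (fperm \<Rightarrow> 'a) \<Rightarrow> bool" where
  "pattern_expansion f c \<longleftrightarrow>
     (\<forall>w. f w = (\<Sum>p | psize p \<le> psize w. c p * of_nat (pattern_count p w)))"

definition pattern_finite :: "(fperm \<Rightarrow> 'a::comm_ring_1) \<Rightarrow> bool" where
  "pattern_finite f \<longleftrightarrow> (\<exists>c. pattern_expansion f c \<and> finite {p. c p \<noteq> 0})"

lemma finite_psize_le: "finite {p. psize p \<le> n}"
proof -
  have "finite (Sigma {..n} (\<lambda>k. {\<sigma>. \<sigma> permutes {1..k}}))"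
    by (intro finite_SigmaI finite_permutations) auto
  moreover have "(\<lambda>p. (psize p, papp p)) ` {p. psize p \<le> n} \<subseteq> Sigma {..n} (\<lambda>k. {\<sigma>. \<sigma> permutes {1..k}})"
    using papp_permutes by auto
  moreover have "inj_on (\<lambda>p. (psize p, papp p)) {p. psize p \<le> n}"
    by (auto intro!: inj_onI fperm_eqI)
  ultimately show "finite {p. psize p \<le> n}"
    using finite_imageD finite_subset by blast
qed

lemma pattern_count_eq_0:
  assumes "psize w < psize p"
  shows "pattern_count p w = 0"
proof -
  have "occurrences p w = {}"
  proof (rule ccontr)
    assume "occurrences p w \<noteq> {}"
    then obtain \<iota> where "\<iota> \<in> {1..psize p} \<rightarrow>\<^sub>E {1..psize w}" and "strict_mono_on {1..psize p} \<iota>"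
      by (auto simp: occurrences_def)
    then have "inj_on \<iota> {1..psize p}" and "\<iota> ` {1..psize p} \<subseteq> {1..psize w}"
      by (auto dest: strict_mono_on_imp_inj_on)
    then have "card {1..psize p} \<le> card {1..psize w}"
      by (intro card_inj_on_le) auto
    with assms show False by simp
  qed
  then show ?thesis by (simp add: pattern_count_def)
qed

text \<open>
  For \<open>m \<ge> 1\<close> the sum has finite support; for \<open>m = 0\<close> it diverges and the value is junk.
\<close>

definition perm_moment :: "nat \<Rightarrow> fperm \<Rightarrow> int" where
  "perm_moment m w = (\<Sum>\<^sub>\<infinity>i\<in>{1..}. (int (papp w i) - int i) ^ m)"

text \<open>
  The truncated subtraction \<open>m - a\<close> is exact for \<open>a \<le> m\<close>. \<open>Stirling\<close> is the library's Stirling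
  number of the second kind.
\<close>

definition kappa :: "nat \<Rightarrow> nat \<Rightarrow> nat \<Rightarrow> int" where
  "kappa m a b =
     (\<Sum>k = b..m - a. (-1) ^ k * int (m choose k)
        * int (fact a) * int (Stirling (m - k) a)
        * int (fact b) * int (Stirling k b))"

end

theory Submission
  imports Defs
begin

text \<open>
  The displacement \<open>w(i) - i\<close> of an entry is the number of entries to its right and below it
  (\<^emph>\<open>southeast\<close> in the plot of \<open>w\<close>) minus the number of entries to its left and above it
  (\<^emph>\<open>northwest\<close>): the entries southwest of it are counted both by \<open>w(i) - 1\<close> and by \<open>i - 1\<close>
  and cancel (\<open>displacement_eq\<close>).

  The coefficients \<open>\<kappa>(m, a, b)\<close> are precisely those of the expansion of \<open>(x - y)\<^sup>m\<close> in the
  products \<open>(x choose a) (y choose b)\<close>: apply the binomial theorem, and write each power as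
  \<open>x\<^sup>n = (\<Sum>k. k! S(n, k) (x choose k))\<close> (\<open>power_diff_eq_sum_kappa\<close>).

  With \<open>x\<close> and \<open>y\<close> the numbers of southeast and northwest entries of \<open>i\<close>, such a product counts
  the choices of \<open>a\<close> entries southeast and \<open>b\<close> entries northwest of \<open>i\<close>. Together with \<open>i\<close>, these
  entries are an occurrence of \<open>q \<ominus> 1 \<ominus> p\<close> in which \<open>i\<close> plays the \<open>1\<close>, where \<open>q\<close> and \<open>p\<close> are the
  patterns of the two chosen groups; conversely, an occurrence of \<open>q \<ominus> 1 \<ominus> p\<close> determines \<open>i\<close> and
  both groups. So summing the product over \<open>i\<close> gives the sum of the counts
  of \<open>q \<ominus> 1 \<ominus> p\<close> over all \<open>p\<close> of size \<open>a\<close> and \<open>q\<close> of size \<open>b\<close>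
  (\<open>sum_pattern_count_skew_sum_one\<close>), and the formula follows by linearity.
\<close>

section \<open>Powers in terms of binomial coefficients\<close>

text \<open>
  The product \<open>k! S(n, k) (x choose k)\<close> counts the maps from an \<open>n\<close>-set to an \<open>x\<close>-set
  whose image has \<open>k\<close> elements. The induction replaces this count by the absorption identity
  below, which turns multiplication by \<open>x\<close> into the recurrence of the Stirling numbers.
\<close>

lemma power_eq_sum_Stirling_binomial:
  "x ^ n = (\<Sum>k\<le>n. Stirling n k * fact k * (x choose k))" for x :: nat
proof (induction n)
  case 0
  show ?case by simp
next
  case (Suc n)
  have absorb: "x * (x choose k) = Suc k * (x choose Suc k) + k * (x choose k)" for k
  proof (cases "k \<le> x")
    case True
    have "Suc k * (x choose Suc k) = (x - k) * (x choose k)"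
      by (simp only: binomial_absorb_comp binomial_absorption)
    with True show ?thesis by (simp flip: add_mult_distrib)
  next
    case False
    then show ?thesis by (simp add: binomial_eq_0)
  qed
  have "x ^ Suc n = (\<Sum>k\<le>n. Stirling n k * fact k * (x * (x choose k)))"
    by (simp add: Suc.IH sum_distrib_left mult_ac)
  also have "\<dots> = (\<Sum>k\<le>n. Stirling n k * fact (Suc k) * (x choose Suc k))
      + (\<Sum>k\<le>n. k * Stirling n k * fact k * (x choose k))"
    unfolding absorb sum.distrib[symmetric] by (intro sum.cong) (simp_all add: algebra_simps)
  also have "(\<Sum>k\<le>n. k * Stirling n k * fact k * (x choose k))
      = (\<Sum>k\<le>Suc n. k * Stirling n k * fact k * (x choose k))"
    by simp
  also have "\<dots> = (\<Sum>k\<le>n. Suc k * Stirling n (Suc k) * fact (Suc k) * (x choose Suc k))"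
    by (subst sum.atMost_Suc_shift) simp
  also have "(\<Sum>k\<le>n. Stirling n k * fact (Suc k) * (x choose Suc k)) + \<dots>
      = (\<Sum>k\<le>Suc n. Stirling (Suc n) k * fact k * (x choose k))"
    by (subst sum.atMost_Suc_shift) (simp add: algebra_simps flip: sum.distrib)
  finally show ?case .
qed

text \<open>
  The summands of \<open>\<kappa>\<close> with \<open>k < b\<close> or \<open>m - k < a\<close> vanish, because \<open>S(n, j) = 0\<close> for \<open>n < j\<close>.
  Summing over a range that does not depend on \<open>a\<close> and \<open>b\<close> makes it possible to exchange
  this sum with those over \<open>a\<close> and \<open>b\<close>.
\<close>

lemma kappa_eq_sum_atMost:
  "kappa m a b = (\<Sum>k\<le>m. (-1) ^ k * int (m choose k)
     * int (fact a) * int (Stirling (m - k) a) * int (fact b) * int (Stirling k b))"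
  unfolding kappa_def
proof (rule sum.mono_neutral_left)
  show "\<forall>k\<in>{..m} - {b..m - a}. (-1) ^ k * int (m choose k)
     * int (fact a) * int (Stirling (m - k) a) * int (fact b) * int (Stirling k b) = 0"
  proof
    fix k assume "k \<in> {..m} - {b..m - a}"
    then have "k < b \<or> m - k < a" by auto
    then show "(-1) ^ k * int (m choose k)
     * int (fact a) * int (Stirling (m - k) a) * int (fact b) * int (Stirling k b) = 0"
      by auto
  qed
qed auto

lemma kappa_eq_0:
  assumes "m < a + b"
  shows "kappa m a b = 0"
  unfolding kappa_eq_sum_atMost
proof (intro sum.neutral ballI)
  fix k assume "k \<in> {..m}"
  with assms have "k < b \<or> m - k < a" by auto
  then show "(-1) ^ k * int (m choose k)
     * int (fact a) * int (Stirling (m - k) a) * int (fact b) * int (Stirling k b) = 0"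
    by auto
qed

lemma power_diff_eq_sum_kappa:
  "(int x - int y) ^ m
     = (\<Sum>(a, b) | a + b \<le> m. kappa m a b * int ((x choose a) * (y choose b)))"
proof -
  have expand: "int z ^ k = (\<Sum>j\<le>m. int (Stirling k j) * int (fact j) * int (z choose j))"
    if "k \<le> m" for z k
  proof -
    have "int z ^ k = (\<Sum>j\<le>k. int (Stirling k j) * int (fact j) * int (z choose j))"
      unfolding of_nat_power[symmetric] power_eq_sum_Stirling_binomial by simp
    also have "\<dots> = (\<Sum>j\<le>m. int (Stirling k j) * int (fact j) * int (z choose j))"
      using that by (intro sum.mono_neutral_left) auto
    finally show ?thesis .
  qed
  have "(int x - int y) ^ m
      = (\<Sum>k\<le>m. (-1) ^ k * int (m choose k) * int x ^ (m - k) * int y ^ k)"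
    using binomial_ring[of "- int y" "int x" m]
    by (simp add: power_minus[of "int y"] mult_ac)
  also have "\<dots> = (\<Sum>k\<le>m. \<Sum>a\<le>m. \<Sum>b\<le>m. (-1) ^ k * int (m choose k)
       * int (fact a) * int (Stirling (m - k) a) * int (fact b) * int (Stirling k b)
       * int ((x choose a) * (y choose b)))"
    by (intro sum.cong refl)
       (simp add: expand sum_distrib_left sum_distrib_right mult_ac sum_product)
  also have "\<dots> = (\<Sum>a\<le>m. \<Sum>b\<le>m. \<Sum>k\<le>m. (-1) ^ k * int (m choose k)
       * int (fact a) * int (Stirling (m - k) a) * int (fact b) * int (Stirling k b)
       * int ((x choose a) * (y choose b)))"
    by (subst sum.swap) (intro sum.cong refl sum.swap)
  also have "\<dots> = (\<Sum>a\<le>m. \<Sum>b\<le>m. kappa m a b * int ((x choose a) * (y choose b)))"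
    by (simp only: kappa_eq_sum_atMost sum_distrib_right)
  also have "\<dots> = (\<Sum>(a, b)\<in>{..m} \<times> {..m}. kappa m a b * int ((x choose a) * (y choose b)))"
    by (rule sum.cartesian_product)
  also have "\<dots> = (\<Sum>(a, b) | a + b \<le> m. kappa m a b * int ((x choose a) * (y choose b)))"
    by (rule sum.mono_neutral_right) (auto, metis kappa_eq_0 not_le)
  finally show ?thesis .
qed

section \<open>Ranks\<close>

text \<open>
  A strictly increasing enumeration is recovered from its image, since the preimage of a value
  is the rank of this value in the image.
\<close>

lemma card_image_le_strict_mono:
  fixes \<iota> :: "nat \<Rightarrow> nat"
  assumes "strict_mono_on {1..k} \<iota>" and r: "r \<in> {1..k}"
  shows "card {z \<in> \<iota> ` {1..k}. z \<le> \<iota> r} = r"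
proof -
  have "{z \<in> \<iota> ` {1..k}. z \<le> \<iota> r} = \<iota> ` {1..r}"
    using r strict_mono_on_less_eq[OF assms(1)] by force
  moreover have "inj_on \<iota> {1..r}"
    using strict_mono_on_imp_inj_on[OF assms(1)] r by (auto intro: inj_on_subset)
  ultimately show ?thesis by (simp add: card_image)
qed

lemma strict_mono_on_eqI:
  fixes \<iota> \<iota>' :: "nat \<Rightarrow> nat"
  assumes "strict_mono_on {1..k} \<iota>" "strict_mono_on {1..k} \<iota>'"
    and image: "\<iota> ` {1..k} = \<iota>' ` {1..k}" and r: "r \<in> {1..k}"
  shows "\<iota> r = \<iota>' r"
proof -
  from image r obtain s where s: "s \<in> {1..k}" "\<iota> r = \<iota>' s" by blast
  have "r = card {z \<in> \<iota> ` {1..k}. z \<le> \<iota> r}"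
    using card_image_le_strict_mono[OF assms(1) r] by simp
  also have "\<dots> = s"
    using card_image_le_strict_mono[OF assms(2) s(1)] by (simp only: image s(2))
  finally show ?thesis using s(2) by simp
qed

lemma ex_strict_mono_enumeration:
  fixes Z :: "nat set"
  assumes "finite Z"
  obtains \<iota> where "\<iota> \<in> extensional {1..card Z}" "strict_mono_on {1..card Z} \<iota>"
    "\<iota> ` {1..card Z} = Z"
proof -
  obtain h where h: "bij_betw h {..<card Z} Z" "strict_mono_on {..<card Z} h"
    using ex_bij_betw_strict_mono_card[OF assms] by blast
  define \<iota> where "\<iota> = restrict (\<lambda>r. h (r - 1)) {1..card Z}"
  have "(\<lambda>r. r - 1) ` {1..card Z} = {..<card Z}"
    by (force simp: image_iff intro: bexI[of _ "Suc _"])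
  then have "\<iota> ` {1..card Z} = Z"
    using h(1) image_image[of h "\<lambda>r. r - 1" "{1..card Z}"]
    by (simp add: \<iota>_def bij_betw_def)
  moreover have "strict_mono_on {1..card Z} \<iota>"
  proof (rule strict_mono_onI)
    fix r s assume "r \<in> {1..card Z}" "s \<in> {1..card Z}" "r < s"
    then show "\<iota> r < \<iota> s"
      using strict_mono_onD[OF h(2), of "r - 1" "s - 1"] by (simp add: \<iota>_def)
  qed
  ultimately show ?thesis
    using that[of \<iota>] by (simp add: \<iota>_def)
qed

text \<open>
  The values of a permutation are their own ranks, so a permutation is determined by the
  relative order of its values.
\<close>

lemma card_le_permutes:
  assumes "\<sigma> permutes {1..n}" and r: "r \<in> {1..n}"
  shows "card {s \<in> {1..n}. \<sigma> s \<le> \<sigma> r} = \<sigma> r"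
proof -
  have "\<sigma> ` {s \<in> {1..n}. \<sigma> s \<le> \<sigma> r} = {v \<in> \<sigma> ` {1..n}. v \<le> \<sigma> r}" by auto
  also have "\<dots> = {1..\<sigma> r}"
    using permutes_image[OF assms(1)] permutes_in_image[OF assms(1), of r] r by auto
  finally have "card (\<sigma> ` {s \<in> {1..n}. \<sigma> s \<le> \<sigma> r}) = \<sigma> r" by simp
  then show ?thesis
    by (subst (asm) card_image) (auto intro: inj_on_subset[OF permutes_inj[OF assms(1)]])
qed

section \<open>Order isomorphism with a permutation\<close>

definition order_iso :: "(nat \<Rightarrow> nat) \<Rightarrow> fperm \<Rightarrow> bool" where
  "order_iso f p \<longleftrightarrow> (\<forall>r\<in>{1..psize p}. \<forall>s\<in>{1..psize p}. f r < f s \<longleftrightarrow> papp p r < papp p s)"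

lemma occurrences_eq:
  "occurrences p w = {\<iota> \<in> {1..psize p} \<rightarrow>\<^sub>E {1..psize w}.
     strict_mono_on {1..psize p} \<iota> \<and> order_iso (\<lambda>r. papp w (\<iota> r)) p}"
  by (simp add: occurrences_def order_iso_def)

lemma order_iso_unique:
  assumes "order_iso f p" "order_iso f q" "psize p = psize q"
  shows "p = q"
proof (rule fperm_eqI[OF assms(3)], rule ext)
  fix r
  show "papp p r = papp q r"
  proof (cases "r \<in> {1..psize p}")
    case True
    have "{s \<in> {1..psize p}. papp p s \<le> papp p r} = {s \<in> {1..psize q}. papp q s \<le> papp q r}"
      using assms True by (auto simp: order_iso_def simp flip: not_less)
    then show ?thesis
      using card_le_permutes[OF papp_permutes, of r p] card_le_permutes[OF papp_permutes, of r q]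
        True assms(3) by simp
  next
    case False
    then show ?thesis
      using permutes_not_in[OF papp_permutes] assms(3) by metis
  qed
qed

text \<open>
  The witness is the standardization of \<open>f\<close>, which replaces each value by its rank.
\<close>

lemma ex_order_iso:
  assumes "inj_on f {1..n}"
  obtains p where "psize p = n" "order_iso f p"
proof -
  define \<sigma> where "\<sigma> r = (if r \<in> {1..n} then card {s \<in> {1..n}. f s \<le> f r} else r)" for r
  have less: "\<sigma> r < \<sigma> s" if "r \<in> {1..n}" "s \<in> {1..n}" "f r < f s" for r s
  proof -
    have "{t \<in> {1..n}. f t \<le> f r} \<subset> {t \<in> {1..n}. f t \<le> f s}"
      using that by (auto simp: psubset_eq set_eq_iff not_le intro!: exI[of _ s])
    then show ?thesis
      using that by (simp add: \<sigma>_def psubset_card_mono)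
  qed
  \<comment> \<open>On a linear order, a strictly monotone passage from \<open>f\<close> to \<open>\<sigma>\<close> also reflects the order.\<close>
  have iso: "f r < f s \<longleftrightarrow> \<sigma> r < \<sigma> s" if "r \<in> {1..n}" "s \<in> {1..n}" for r s
    using less[OF that] less[OF that(2) that(1)] inj_onD[OF assms _ that]
    by (metis less_asym' linorder_neqE_nat)
  have "inj_on \<sigma> {1..n}"
    using iso inj_onD[OF assms] by (intro inj_onI) (metis less_irrefl linorder_neqE_nat)
  moreover have "\<sigma> r \<in> {1..n}" if "r \<in> {1..n}" for r
  proof -
    have "card {s \<in> {1..n}. f s \<le> f r} \<le> card {1..n}" by (intro card_mono) auto
    moreover have "1 \<le> card {s \<in> {1..n}. f s \<le> f r}"
      unfolding One_nat_def Suc_le_eq card_gt_0_iff using that by auto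
    ultimately show ?thesis using that by (simp add: \<sigma>_def)
  qed
  ultimately have "bij_betw \<sigma> {1..n} {1..n}"
    by (intro bij_betw_imageI endo_inj_surj) auto
  then have perm: "\<sigma> permutes {1..n}"
    by (rule bij_imp_permutes) (auto simp: \<sigma>_def)
  define p where "p = Abs_fperm (n, \<sigma>)"
  have "psize p = n" "papp p = \<sigma>"
    using perm by (simp_all add: p_def psize.rep_eq papp.rep_eq Abs_fperm_inverse)
  with iso show ?thesis
    using that[of p] by (simp add: order_iso_def)
qed

lemma psize_perm_one [simp]: "psize perm_one = 1"
  by transfer simp

lemma psize_skew_sum [simp]: "psize (p \<ominus> q) = psize p + psize q"
  by transfer auto

lemma papp_skew_sum: "papp (p \<ominus> q) = skew_fun (psize p) (papp p) (psize q) (papp q)"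
  by transfer auto

lemma order_iso_perm_one: "order_iso f perm_one"
  by (simp add: order_iso_def)

lemma order_iso_skew_sum:
  "order_iso f (p \<ominus> q) \<longleftrightarrow>
     order_iso f p \<and> order_iso (\<lambda>s. f (psize p + s)) q \<and>
     (\<forall>r\<in>{1..psize p}. \<forall>s\<in>{1..psize q}. f (psize p + s) < f r)"
  (is "?L \<longleftrightarrow> ?R")
proof -
  let ?a = "psize p" and ?b = "psize q"
  have left: "papp (p \<ominus> q) r = ?b + papp p r" "1 \<le> papp p r" if "r \<in> {1..?a}" for r
    using that permutes_in_image[OF papp_permutes[of p], of r]
    by (simp_all add: papp_skew_sum skew_fun_def)
  have right: "papp (p \<ominus> q) (?a + s) = papp q s" "papp q s \<le> ?b" if "s \<in> {1..?b}" for s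
    using that permutes_in_image[OF papp_permutes[of q], of s]
    by (auto simp add: papp_skew_sum skew_fun_def)
  have split: "{1..psize (p \<ominus> q)} = {1..?a} \<union> (+) ?a ` {1..?b}"
    by (auto simp: image_iff Bex_def)
  have cross: "papp (p \<ominus> q) (?a + s) < papp (p \<ominus> q) r" if "r \<in> {1..?a}" "s \<in> {1..?b}" for r s
    using left[OF that(1)] right[OF that(2)] by linarith
  show ?thesis
    unfolding order_iso_def split ball_Un ball_simps
    using left right cross by (auto simp: not_less) (meson atLeastAtMost_iff less_asym less_imp_le)+
qed

section \<open>Displacement of an entry\<close>

definition southeast :: "fperm \<Rightarrow> nat \<Rightarrow> nat set" where
  "southeast w i = {j \<in> {1..psize w}. i < j \<and> papp w j < papp w i}"

definition northwest :: "fperm \<Rightarrow> nat \<Rightarrow> nat set" where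
  "northwest w i = {j \<in> {1..psize w}. j < i \<and> papp w i < papp w j}"

lemma finite_southeast: "finite (southeast w i)"
  by (simp add: southeast_def)

lemma finite_northwest: "finite (northwest w i)"
  by (simp add: northwest_def)

text \<open>
  The entries weakly southwest of \<open>i\<close>, the set \<open>?U\<close> below, together with the southeast ones are
  the \<open>w(i)\<close> entries of value at most \<open>w(i)\<close>; together with the northwest ones they are the \<open>i\<close>
  entries of position at most \<open>i\<close>. The two counts share the same \<open>?U\<close>.
\<close>

lemma displacement_eq:
  assumes i: "i \<in> {1..psize w}"
  shows "int (papp w i) - int i = int (card (southeast w i)) - int (card (northwest w i))"
proof -
  let ?U = "{j \<in> {1..psize w}. j \<le> i \<and> papp w j \<le> papp w i}"
  have neq: "papp w j \<noteq> papp w i" if "j \<noteq> i" for j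
    using permutes_inj[OF papp_permutes[of w]] that by (auto dest: injD)
  have "{j \<in> {1..psize w}. papp w j \<le> papp w i} = southeast w i \<union> ?U"
    by (auto simp: southeast_def not_le order.strict_iff_order neq)
  moreover have "southeast w i \<inter> ?U = {}"
    by (auto simp: southeast_def)
  ultimately have papp_eq: "papp w i = card (southeast w i) + card ?U"
    using card_le_permutes[OF papp_permutes i]
    by (simp add: card_Un_disjoint finite_southeast)
  have "{1..i} = northwest w i \<union> ?U"
    using i neq by (force simp: northwest_def not_le order.strict_iff_order)
  moreover have "northwest w i \<inter> ?U = {}"
    by (auto simp: northwest_def)
  moreover have "card {1..i} = i" by simp
  ultimately have "i = card (northwest w i) + card ?U"
    by (simp add: card_Un_disjoint finite_northwest)
  with papp_eq show ?thesis by linarith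
qed

section \<open>Occurrences of skew sums around a middle entry\<close>

text \<open>
  These are the increasing choices of positions that form an occurrence of \<open>q \<ominus> 1 \<ominus> p\<close> for some
  \<open>q\<close> of size \<open>b\<close> and some \<open>p\<close> of size \<open>a\<close>. The inequalities compare entries with the middle one
  only; those between the first \<open>b\<close> and the last \<open>a\<close> entries follow by transitivity.
\<close>

definition centred_choices :: "fperm \<Rightarrow> nat \<Rightarrow> nat \<Rightarrow> (nat \<Rightarrow> nat) set" where
  "centred_choices w a b =
     {\<iota> \<in> {1..b + 1 + a} \<rightarrow>\<^sub>E {1..psize w}. strict_mono_on {1..b + 1 + a} \<iota> \<and>
        (\<forall>r\<in>{1..b}. papp w (\<iota> (b + 1)) < papp w (\<iota> r)) \<and>
        (\<forall>s\<in>{1..a}. papp w (\<iota> (b + 1 + s)) < papp w (\<iota> (b + 1)))}"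

lemma order_iso_skew_sum_one:
  "order_iso f (q \<ominus> perm_one \<ominus> p) \<longleftrightarrow>
     order_iso f q \<and> order_iso (\<lambda>s. f (psize q + 1 + s)) p \<and>
     (\<forall>r\<in>{1..psize q}. f (psize q + 1) < f r) \<and>
     (\<forall>s\<in>{1..psize p}. f (psize q + 1 + s) < f (psize q + 1))"
  (is "_ \<longleftrightarrow> ?R")
proof -
  let ?b = "psize q"
  have "{1..?b + 1} = insert (?b + 1) {1..?b}" by auto
  then have "order_iso f (q \<ominus> perm_one \<ominus> p) \<longleftrightarrow>
      ?R \<and> (\<forall>r\<in>{1..?b}. \<forall>s\<in>{1..psize p}. f (?b + 1 + s) < f r)"
    unfolding order_iso_skew_sum psize_skew_sum psize_perm_one
    by (auto simp: order_iso_perm_one)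
  then show ?thesis
    by (meson less_trans)
qed

lemma occurrences_skew_sum_one:
  assumes "psize p = a" "psize q = b"
  shows "occurrences (q \<ominus> perm_one \<ominus> p) w = {\<iota> \<in> centred_choices w a b.
     order_iso (\<lambda>r. papp w (\<iota> r)) q \<and> order_iso (\<lambda>s. papp w (\<iota> (b + 1 + s))) p}"
  using assms by (auto simp: occurrences_eq order_iso_skew_sum_one centred_choices_def)

lemma finite_centred_choices: "finite (centred_choices w a b)"
  by (rule finite_subset[of _ "{1..b + 1 + a} \<rightarrow>\<^sub>E {1..psize w}"])
     (auto simp: centred_choices_def intro: finite_PiE)

lemma finite_psize_eq: "finite {p. psize p = n}"
  by (rule finite_subset[OF _ finite_psize_le[of n]]) auto

text \<open>
  Standardizing the first \<open>b\<close> and the last \<open>a\<close> chosen entries yields, for each choice of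
  positions, exactly one pair \<open>(p, q)\<close> for which it is an occurrence. Hence the sets of
  occurrences partition the set of choices.
\<close>

lemma sum_pattern_count_eq_card_centred_choices:
  "(\<Sum>(p, q)\<in>{p. psize p = a} \<times> {q. psize q = b}. pattern_count (q \<ominus> perm_one \<ominus> p) w)
     = card (centred_choices w a b)"
proof -
  let ?D = "{p. psize p = a} \<times> {q. psize q = b}"
  let ?O = "\<lambda>(p, q). occurrences (q \<ominus> perm_one \<ominus> p) w"
  have cover: "\<exists>x\<in>?D. \<iota> \<in> ?O x" if \<iota>: "\<iota> \<in> centred_choices w a b" for \<iota>
  proof -
    have "inj_on \<iota> {1..b + 1 + a}"
      using \<iota> by (auto simp: centred_choices_def dest: strict_mono_on_imp_inj_on)
    then have inj: "inj_on (\<lambda>r. papp w (\<iota> r)) {1..b + 1 + a}"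
      using permutes_inj[OF papp_permutes[of w]] by (auto simp: inj_on_def)
    have "inj_on (\<lambda>r. papp w (\<iota> r)) {1..b}"
      using inj by (rule inj_on_subset) auto
    then obtain q where q: "psize q = b" "order_iso (\<lambda>r. papp w (\<iota> r)) q"
      by (rule ex_order_iso)
    have "inj_on (\<lambda>s. papp w (\<iota> (b + 1 + s))) {1..a}"
      using inj unfolding inj_on_def by fastforce
    then obtain p where p: "psize p = a" "order_iso (\<lambda>s. papp w (\<iota> (b + 1 + s))) p"
      by (rule ex_order_iso)
    show ?thesis
      using p q \<iota> by (intro bexI[of _ "(p, q)"]) (simp_all add: occurrences_skew_sum_one)
  qed
  have sub: "?O x \<subseteq> centred_choices w a b" if "x \<in> ?D" for x
    using that by (auto simp: occurrences_skew_sum_one)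
  have disj: "?O x \<inter> ?O y = {}" if "x \<in> ?D" "y \<in> ?D" "x \<noteq> y" for x y
    using that by (auto simp: occurrences_skew_sum_one dest: order_iso_unique)
  have "centred_choices w a b = (\<Union>x\<in>?D. ?O x)"
    using cover sub by blast
  moreover have "card (\<Union>x\<in>?D. ?O x) = (\<Sum>x\<in>?D. card (?O x))"
  proof (rule card_UN_disjoint)
    show "finite ?D" by (simp add: finite_psize_eq)
    show "\<forall>x\<in>?D. finite (?O x)"
      using finite_subset[OF sub finite_centred_choices] by blast
    show "\<forall>x\<in>?D. \<forall>y\<in>?D. x \<noteq> y \<longrightarrow> ?O x \<inter> ?O y = {}"
      using disj by blast
  qed
  ultimately show ?thesis
    by (simp add: pattern_count_def case_prod_unfold)
qed

text \<open>
  The increasing order of positions leaves no freedom: the positions northwest of \<open>i\<close> precede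
  \<open>i\<close>, and those southeast of it follow. So a choice is the same as its middle position with
  the two sets of positions around it, and the inverse map enumerates their union increasingly.
\<close>

lemma bij_betw_centred_choices:
  "bij_betw (\<lambda>\<iota>. (\<iota> (b + 1), \<iota> ` {b + 2..b + 1 + a}, \<iota> ` {1..b})) (centred_choices w a b)
     (SIGMA i:{1..psize w}. {X. X \<subseteq> southeast w i \<and> card X = a}
        \<times> {Y. Y \<subseteq> northwest w i \<and> card Y = b})"
  (is "bij_betw ?\<Phi> _ ?T")
proof -
  let ?k = "b + 1 + a"
  have split: "{1..?k} = insert (b + 1) ({b + 2..?k} \<union> {1..b})" by auto
  have into: "?\<Phi> \<iota> \<in> ?T" if \<iota>: "\<iota> \<in> centred_choices w a b" for \<iota>
  proof -
    have mono: "strict_mono_on {1..?k} \<iota>" and range: "\<And>r. r \<in> {1..?k} \<Longrightarrow> \<iota> r \<in> {1..psize w}"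
      using \<iota> by (auto simp: centred_choices_def PiE_iff)
    have nw: "\<iota> r \<in> northwest w (\<iota> (b + 1))" if "r \<in> {1..b}" for r
      using that \<iota> range[of r] strict_mono_onD[OF mono, of r "b + 1"]
      by (auto simp: centred_choices_def northwest_def)
    have se: "\<iota> r \<in> southeast w (\<iota> (b + 1))" if r: "r \<in> {b + 2..?k}" for r
    proof -
      from r have "r - (b + 1) \<in> {1..a}" "r = b + 1 + (r - (b + 1))" by auto
      then have "papp w (\<iota> r) < papp w (\<iota> (b + 1))"
        using \<iota> unfolding centred_choices_def by (metis (mono_tags, lifting) mem_Collect_eq)
      then show ?thesis
        using r range[of r] strict_mono_onD[OF mono, of "b + 1" r] by (auto simp: southeast_def)
    qed
    have "inj_on \<iota> {b + 2..?k}" "inj_on \<iota> {1..b}"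
      using strict_mono_on_imp_inj_on[OF mono] by (auto intro: inj_on_subset)
    then show ?thesis
      using nw se range[of "b + 1"] by (auto simp: card_image)
  qed
  have inj: "inj_on ?\<Phi> (centred_choices w a b)"
  proof (rule inj_onI)
    fix \<iota> \<iota>' assume in_choices: "\<iota> \<in> centred_choices w a b" "\<iota>' \<in> centred_choices w a b"
      and eq: "?\<Phi> \<iota> = ?\<Phi> \<iota>'"
    then have "\<iota> ` {1..?k} = \<iota>' ` {1..?k}"
      unfolding split image_insert image_Un by simp
    moreover have "strict_mono_on {1..?k} \<iota>" "strict_mono_on {1..?k} \<iota>'"
      "\<iota> \<in> extensional {1..?k}" "\<iota>' \<in> extensional {1..?k}"
      using in_choices by (auto simp: centred_choices_def PiE_def)
    ultimately show "\<iota> = \<iota>'"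
      by (metis extensionalityI strict_mono_on_eqI)
  qed
  have surj: "\<exists>\<iota>\<in>centred_choices w a b. ?\<Phi> \<iota> = (i, X, Y)"
    if i: "i \<in> {1..psize w}" and X: "X \<subseteq> southeast w i" "card X = a"
      and Y: "Y \<subseteq> northwest w i" "card Y = b" for i X Y
  proof -
    define Z where "Z = insert i (X \<union> Y)"
    have fin: "finite X" "finite Y"
      using X Y finite_southeast finite_northwest finite_subset by blast+
    have X_gt: "i < x" if "x \<in> X" for x using that X by (auto simp: southeast_def)
    have Y_lt: "y < i" if "y \<in> Y" for y using that Y by (auto simp: northwest_def)
    have "X \<inter> Y = {}" "i \<notin> X \<union> Y" using X_gt Y_lt by force+
    then have card_Z: "card Z = ?k" and "finite Z"
      using fin X Y by (simp_all add: Z_def card_Un_disjoint)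
    then obtain \<iota> where \<iota>: "\<iota> \<in> extensional {1..?k}" "strict_mono_on {1..?k} \<iota>" "\<iota> ` {1..?k} = Z"
      using ex_strict_mono_enumeration[of Z] by metis
    then obtain t where t: "t \<in> {1..?k}" "i = \<iota> t" by (metis Z_def imageE insertI1)
    \<comment> \<open>The rank of \<open>i\<close> in \<open>Z\<close> shows that the enumeration puts \<open>i\<close> in the middle.\<close>
    have "{z \<in> Z. z \<le> i} = insert i Y"
      using X_gt Y_lt by (force simp: Z_def)
    then have "t = b + 1"
      using card_image_le_strict_mono[OF \<iota>(2) t(1)] \<iota>(3) t(2) fin Y_lt Y(2) by force
    then have mid: "\<iota> (b + 1) = i" using t by simp
    have less: "\<iota> r < i \<longleftrightarrow> r < b + 1" "i < \<iota> r \<longleftrightarrow> b + 1 < r" if "r \<in> {1..?k}" for r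
      using that strict_mono_on_less[OF \<iota>(2), of r "b + 1"] strict_mono_on_less[OF \<iota>(2), of "b + 1" r]
      unfolding mid by auto
    have "Y = {z \<in> Z. z < i}" using X_gt Y_lt by (force simp: Z_def)
    also have "\<dots> = \<iota> ` {r \<in> {1..?k}. \<iota> r < i}" using \<iota>(3) by auto
    also have "{r \<in> {1..?k}. \<iota> r < i} = {1..b}" using less by auto
    finally have Y_eq: "\<iota> ` {1..b} = Y" by simp
    have "X = {z \<in> Z. i < z}" using X_gt Y_lt by (force simp: Z_def)
    also have "\<dots> = \<iota> ` {r \<in> {1..?k}. i < \<iota> r}" using \<iota>(3) by auto
    also have "{r \<in> {1..?k}. i < \<iota> r} = {b + 2..?k}" using less by auto
    finally have X_eq: "\<iota> ` {b + 2..?k} = X" by simp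
    have "Z \<subseteq> {1..psize w}"
      using i X Y by (auto simp: Z_def southeast_def northwest_def)
    then have "\<iota> \<in> {1..?k} \<rightarrow>\<^sub>E {1..psize w}"
      using \<iota>(1,3) by (auto simp: PiE_def)
    moreover have "papp w (\<iota> (b + 1)) < papp w (\<iota> r)" if "r \<in> {1..b}" for r
      using that Y Y_eq mid by (auto simp: northwest_def)
    moreover have "papp w (\<iota> (b + 1 + s)) < papp w (\<iota> (b + 1))" if "s \<in> {1..a}" for s
    proof -
      have "b + 1 + s \<in> {b + 2..?k}" using that by simp
      then have "\<iota> (b + 1 + s) \<in> X" using X_eq by blast
      then show ?thesis using X mid by (auto simp: southeast_def)
    qed
    ultimately have "\<iota> \<in> centred_choices w a b"
      using \<iota>(2) by (simp add: centred_choices_def)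
    then show ?thesis using mid X_eq Y_eq by blast
  qed
  show ?thesis
    unfolding bij_betw_def
  proof (intro conjI inj equalityI)
    show "?\<Phi> ` centred_choices w a b \<subseteq> ?T" using into by blast
    show "?T \<subseteq> ?\<Phi> ` centred_choices w a b"
    proof
      fix x assume "x \<in> ?T"
      then obtain i X Y where x: "x = (i, X, Y)" and "i \<in> {1..psize w}"
        "X \<subseteq> southeast w i" "card X = a" "Y \<subseteq> northwest w i" "card Y = b"
        by blast
      then obtain \<iota> where "\<iota> \<in> centred_choices w a b" "?\<Phi> \<iota> = (i, X, Y)"
        using surj[of i X Y] by blast
      then show "x \<in> ?\<Phi> ` centred_choices w a b"
        unfolding x by (intro image_eqI[of _ _ \<iota>]) simp_all
    qed
  qed
qed

lemma sum_pattern_count_skew_sum_one: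
  "(\<Sum>(p, q)\<in>{p. psize p = a} \<times> {q. psize q = b}. pattern_count (q \<ominus> perm_one \<ominus> p) w)
     = (\<Sum>i = 1..psize w. (card (southeast w i) choose a) * (card (northwest w i) choose b))"
  unfolding sum_pattern_count_eq_card_centred_choices bij_betw_same_card[OF bij_betw_centred_choices]
  by (subst card_SigmaI)
     (auto simp: card_cartesian_product n_subsets finite_southeast finite_northwest
       intro!: finite_cartesian_product)

section \<open>Permutation moments\<close>

lemma perm_moment_eq_sum:
  assumes "m \<ge> 1"
  shows "perm_moment m w = (\<Sum>i = 1..psize w. (int (papp w i) - int i) ^ m)"
proof -
  have "perm_moment m w = (\<Sum>\<^sub>\<infinity>i\<in>{1..psize w}. (int (papp w i) - int i) ^ m)"
    unfolding perm_moment_def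
  proof (rule infsum_cong_neutral)
    fix i assume "i \<in> {1..} - {1..psize w}"
    then have "papp w i = i" by (intro permutes_not_in[OF papp_permutes]) auto
    with assms show "(int (papp w i) - int i) ^ m = 0" by simp
  qed auto
  then show ?thesis by simp
qed

text \<open>
  Distinct indices may give the same pattern: \<open>q \<ominus> 1 \<ominus> p\<close> does not determine \<open>(p, q)\<close>, as
  \<open>1 \<ominus> 1 \<ominus> \<emptyset> = \<emptyset> \<ominus> 1 \<ominus> 1\<close> shows. The coefficient of a pattern therefore collects a whole fibre
  of \<open>h\<close>.
\<close>

lemma pattern_finite_sum:
  fixes k :: "'b \<Rightarrow> 'a::comm_ring_1"
  assumes "finite D"
  shows "pattern_finite (\<lambda>w. \<Sum>x\<in>D. k x * of_nat (pattern_count (h x) w))"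
proof -
  define c where "c r = (\<Sum>x | x \<in> D \<and> h x = r. k x)" for r
  have c_0: "c r = 0" if "r \<notin> h ` D" for r
  proof -
    from that have "{x. x \<in> D \<and> h x = r} = {}" by blast
    then show ?thesis by (simp only: c_def sum.empty)
  qed
  have "(\<Sum>x\<in>D. k x * of_nat (pattern_count (h x) w))
      = (\<Sum>r | psize r \<le> psize w. c r * of_nat (pattern_count r w))" for w
  proof -
    have "(\<Sum>x\<in>D. k x * of_nat (pattern_count (h x) w))
        = (\<Sum>r\<in>h ` D. \<Sum>x | x \<in> D \<and> h x = r. k x * of_nat (pattern_count (h x) w))"
      using assms by (rule sum.image_gen)
    also have "\<dots> = (\<Sum>r\<in>h ` D. c r * of_nat (pattern_count r w))"
      by (simp add: c_def sum_distrib_right)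
    also have "\<dots> = (\<Sum>r\<in>h ` D \<union> {r. psize r \<le> psize w}. c r * of_nat (pattern_count r w))"
      using assms by (intro sum.mono_neutral_left) (auto simp: c_0 finite_psize_le)
    also have "\<dots> = (\<Sum>r | psize r \<le> psize w. c r * of_nat (pattern_count r w))"
      using assms by (intro sum.mono_neutral_right) (auto simp: finite_psize_le pattern_count_eq_0)
    finally show ?thesis .
  qed
  moreover have "finite {r. c r \<noteq> 0}"
    by (rule finite_subset[of _ "h ` D"]) (use c_0 assms in auto)
  ultimately show ?thesis
    unfolding pattern_finite_def pattern_expansion_def by blast
qed

lemma finite_psize_add_le: "finite {(p, q). psize p + psize q \<le> m}"
  by (rule finite_subset[of _ "{p. psize p \<le> m} \<times> {q. psize q \<le> m}"])
     (auto simp: finite_psize_le)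

lemma perm_moment_eq_sum_kappa:
  assumes "m \<ge> 1"
  shows "perm_moment m w = (\<Sum>(p, q) | psize p + psize q \<le> m.
    kappa m (psize p) (psize q) * int (pattern_count (q \<ominus> perm_one \<ominus> p) w))"
proof -
  let ?se = "\<lambda>i. card (southeast w i)" and ?nw = "\<lambda>i. card (northwest w i)"
  let ?D = "{(p, q). psize p + psize q \<le> m}" and ?E = "{(a, b). a + b \<le> m}"
  let ?g = "\<lambda>(p, q). kappa m (psize p) (psize q) * int (pattern_count (q \<ominus> perm_one \<ominus> p) w)"
  let ?s = "map_prod psize psize"
  have "finite ?E"
    by (rule finite_subset[of _ "{..m} \<times> {..m}"]) auto
  \<comment> \<open>As \<open>\<kappa>\<close> depends on the sizes of \<open>p\<close> and \<open>q\<close> alone, the sum splits into blocks of fixed sizes.\<close>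
  have block: "sum ?g {x \<in> ?D. ?s x = (a, b)}
      = kappa m a b * int (\<Sum>i = 1..psize w. (?se i choose a) * (?nw i choose b))"
    if "a + b \<le> m" for a b
  proof -
    from that have "{x \<in> ?D. ?s x = (a, b)} = {p. psize p = a} \<times> {q. psize q = b}" by auto
    then have "sum ?g {x \<in> ?D. ?s x = (a, b)}
        = (\<Sum>x\<in>{p. psize p = a} \<times> {q. psize q = b}. 
            kappa m a b * int (case x of (p, q) \<Rightarrow> pattern_count (q \<ominus> perm_one \<ominus> p) w))"
      by (auto intro!: sum.cong)
    then show ?thesis
      by (simp only: sum_distrib_left[symmetric] of_nat_sum[symmetric]
            sum_pattern_count_skew_sum_one)
  qed
  have "perm_moment m w = (\<Sum>i = 1..psize w. (int (?se i) - int (?nw i)) ^ m)"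
    unfolding perm_moment_eq_sum[OF assms] by (intro sum.cong refl) (simp only: displacement_eq)
  also have "\<dots> = (\<Sum>i = 1..psize w. \<Sum>(a, b)\<in>?E. kappa m a b * int ((?se i choose a) * (?nw i choose b)))"
    by (simp only: power_diff_eq_sum_kappa)
  also have "\<dots> = (\<Sum>(a, b)\<in>?E. \<Sum>i = 1..psize w. kappa m a b * int ((?se i choose a) * (?nw i choose b)))"
    unfolding case_prod_unfold by (rule sum.swap)
  also have "\<dots> = (\<Sum>y\<in>?E. sum ?g {x \<in> ?D. ?s x = y})"
  proof (intro sum.cong refl)
    fix y assume "y \<in> ?E"
    then obtain a b where y: "y = (a, b)" "a + b \<le> m" by blast
    show "(case y of (a, b) \<Rightarrow> \<Sum>i = 1..psize w. kappa m a b * int ((?se i choose a) * (?nw i choose b)))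
        = sum ?g {x \<in> ?D. ?s x = y}"
      unfolding y(1) block[OF y(2)] by (simp only: case_prod_conv sum_distrib_left of_nat_sum)
  qed
  also have "\<dots> = sum ?g ?D"
    using finite_psize_add_le \<open>finite ?E\<close> by (intro sum.group) auto
  finally show ?thesis .
qed

theorem theorem3p8:
  fixes m :: nat
  assumes "m \<ge> 1"
  shows "pattern_finite (perm_moment m) \<and>
    perm_moment m =
      (\<lambda>w. \<Sum>(p, q) | psize p + psize q \<le> m.
         kappa m (psize p) (psize q) * int (pattern_count (q \<ominus> perm_one \<ominus> p) w))"
proof -
  have eq: "perm_moment m =
      (\<lambda>w. \<Sum>(p, q) | psize p + psize q \<le> m.
         kappa m (psize p) (psize q) * int (pattern_count (q \<ominus> perm_one \<ominus> p) w))"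
    using perm_moment_eq_sum_kappa[OF assms] by (rule ext)
  have "pattern_finite (perm_moment m)"
    unfolding eq case_prod_unfold
    using finite_psize_add_le[of m] unfolding case_prod_unfold by (rule pattern_finite_sum)
  with eq show ?thesis by blast
qed

end
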